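(* Let $n$ be a positive integer and suppose that $\mathcal{F}\subseteq 2^{[n]}$ satisfies $\Delta(\mathcal{F})\leq 2$. Then $\mathcal{F}$ is contained in a translation of $\mathcal{K}(n,2)$, or in a translation of $\mathcal{H}(n,2)$ (for some distinct $a,b\in[n]$), or in a translation of $\mathcal{V}(n,2)$ (for some distinct $a,b,c\in[n]$).
   Context: $[n]=\{1,\dots,n\}$ and $2^{[n]}$ is its power set. For $A,B\subseteq[n]$, $A+B=(A\setminus B)\cup(B\setminus A)$ denotes the symmetric difference. The diameter of $\mathcal{F}\subseteq 2^{[n]}$ is $\Delta(\mathcal{F})=\max\{|A+B|: A,B\in\mathcal{F}\}$. For $S\subseteq[n]$, the translation of a family $\mathcal{G}\subseteq 2^{[n]}$ by $S$ is $\mathcal{G}+S=\{G+S: G\in\mathcal{G}\}$; "a translation of $\mathcal{G}$" means $\mathcal{G}+S$ for some $S\subseteq[n]$. Families: $\mathcal{K}(n,2)=\{F\subseteq[n]: |F|\leq 1\}$; for distinct $a,b\in[n]$, $\mathcal{H}(n,2)=\{\emptyset,\{a\},\{b\},\{a,b\}\}$; for distinct $a,b,c\in[n]$, $\mathcal{V}(n,2)=\{\{a\},\{b\},\{c\},\{a,b,c\}\}$. *)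

theory Defs
  imports Main
begin

(* Sup on nat is the maximum for finite nonempty sets; for the empty family it gives diameter 0. *)
definition diam :: "nat set set \<Rightarrow> nat" where
  "diam \<F> = Sup {card (sym_diff A B) | A B. A \<in> \<F> \<and> B \<in> \<F>}"

definition translate :: "nat set set \<Rightarrow> nat set \<Rightarrow> nat set set" where
  "translate \<G> S = {sym_diff G S | G. G \<in> \<G>}"

definition famK :: "nat \<Rightarrow> nat set set" where
  "famK n = {F. F \<subseteq> {1..n} \<and> card F \<le> 1}"

definition famH :: "nat \<Rightarrow> nat \<Rightarrow> nat set set" where
  "famH a b = {{}, {a}, {b}, {a, b}}"

definition famV :: "nat \<Rightarrow> nat \<Rightarrow> nat \<Rightarrow> nat set set" where
  "famV a b c = {{a}, {b}, {c}, {a, b, c}}"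

end

theory Submission
  imports Defs
begin

text \<open>Translate the family so that it contains the empty set; then all its members have at most two
  elements. If a singleton \<open>{a}\<close> occurs, the other members are singletons \<open>{x}\<close> and pairs \<open>{a, y}\<close>,
  and \<open>x = y\<close> whenever both kinds occur, which gives a family of type \<open>K\<close> or \<open>H\<close>. Otherwise the
  nonempty members are pairwise intersecting pairs, so they form a star (type \<open>K\<close>) or a triangle
  (type \<open>V\<close>).\<close>

section \<open>Translations, the diameter bound and sets with at most two elements\<close>

lemma translate_iff: "A \<in> translate \<G> S \<longleftrightarrow> sym_diff A S \<in> \<G>"
proof -
  have "sym_diff (sym_diff A S) S = A" for A
    by blast
  then show ?thesis
    unfolding translate_def by (smt (verit) mem_Collect_eq)
qed

lemma translate_translate: "translate (translate \<G> S) T = translate \<G> (sym_diff S T)"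
proof -
  have "sym_diff (sym_diff A T) S = sym_diff A (sym_diff S T)" for A
    by blast
  then show ?thesis
    by (auto simp only: set_eq_iff[of "translate _ _"] translate_iff)
qed

text \<open>Translation by \<open>S\<close> is its own inverse, so it can be moved across an
  inclusion.\<close>

lemma translate_subset_iff: "translate \<F> S \<subseteq> \<G> \<longleftrightarrow> \<F> \<subseteq> translate \<G> S"
  unfolding subset_iff[of _ "translate _ _"] translate_iff by (auto simp: translate_def)

lemma card_sym_diff_le_diam:
  assumes "\<F> \<subseteq> Pow {1..n}" "A \<in> \<F>" "B \<in> \<F>"
  shows "card (sym_diff A B) \<le> diam \<F>"
proof -
  \<comment> \<open>On \<open>nat\<close>, \<open>Sup\<close> is known to be an upper bound only for
    bounded sets; finiteness supplies this.\<close>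
  have "finite \<F>"
    using assms(1) by (rule finite_subset) simp
  then have "finite ((\<lambda>(A, B). card (sym_diff A B)) ` (\<F> \<times> \<F>))"
    by simp
  moreover have "{card (sym_diff A B) | A B. A \<in> \<F> \<and> B \<in> \<F>}
      = (\<lambda>(A, B). card (sym_diff A B)) ` (\<F> \<times> \<F>)"
    by auto
  ultimately show ?thesis
    unfolding diam_def using assms(2,3) by (intro le_cSup_finite) auto
qed

text \<open>Pigeonhole form of the bound: contradictions then come from exhibiting three distinct
  elements, without computing cardinalities. An infinite set has \<open>card\<close> 0, hence the
  finiteness hypothesis.\<close>

lemma card_le_2_iff:
  assumes "finite X"
  shows "card X \<le> 2 \<longleftrightarrow> (\<forall>x\<in>X. \<forall>y\<in>X. \<forall>z\<in>X. x = y \<or> x = z \<or> y = z)"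
proof
  assume le: "card X \<le> 2"
  show "\<forall>x\<in>X. \<forall>y\<in>X. \<forall>z\<in>X. x = y \<or> x = z \<or> y = z"
  proof (intro ballI, rule ccontr)
    fix x y z assume "x \<in> X" "y \<in> X" "z \<in> X" and "\<not> (x = y \<or> x = z \<or> y = z)"
    then have "card {x, y, z} = 3" "{x, y, z} \<subseteq> X"
      by auto
    then show False
      using le card_mono[OF assms, of "{x, y, z}"] by simp
  qed
next
  assume R: "\<forall>x\<in>X. \<forall>y\<in>X. \<forall>z\<in>X. x = y \<or> x = z \<or> y = z"
  show "card X \<le> 2"
  proof (rule ccontr)
    assume "\<not> card X \<le> 2"
    then have "3 \<le> card X"
      by simp
    then obtain Y where "Y \<subseteq> X" "card Y = 3"
      by (rule obtain_subset_with_card_n)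
    then show False
      using R by (auto simp: card_3_iff)
  qed
qed

lemma card_le_2_cases:
  assumes "finite X" "card X \<le> 2"
  obtains "X = {}" | x where "X = {x}" | x y where "X = {x, y}" "x \<noteq> y"
proof -
  have "card X = 0 \<or> card X = 1 \<or> card X = 2"
    using assms by linarith
  then show thesis
    using assms that by (auto simp: card_1_singleton_iff card_2_iff)
qed

lemma mem_famK:
  "{} \<in> famK n" "x \<in> {1..n} \<Longrightarrow> {x} \<in> famK n"
  by (auto simp: famK_def)

lemma sym_diff_pair_singleton: "x \<noteq> y \<Longrightarrow> sym_diff {x, y} {x} = {y}"
  by blast

section \<open>The conclusion as a predicate that can be carried along translations\<close>

definition KHV_bounded :: "nat \<Rightarrow> nat set set \<Rightarrow> bool" where
  "KHV_bounded n \<F> \<longleftrightarrow> (\<exists>S. S \<subseteq> {1..n} \<and> \<F> \<subseteq> translate (famK n) S)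
    \<or> (\<exists>a b S. a \<in> {1..n} \<and> b \<in> {1..n} \<and> a \<noteq> b \<and> S \<subseteq> {1..n}
          \<and> \<F> \<subseteq> translate (famH a b) S)
    \<or> (\<exists>a b c S. a \<in> {1..n} \<and> b \<in> {1..n} \<and> c \<in> {1..n}
          \<and> a \<noteq> b \<and> a \<noteq> c \<and> b \<noteq> c \<and> S \<subseteq> {1..n}
          \<and> \<F> \<subseteq> translate (famV a b c) S)"

lemma KHV_boundedI:
  "S \<subseteq> {1..n} \<Longrightarrow> \<F> \<subseteq> translate (famK n) S \<Longrightarrow> KHV_bounded n \<F>"
  "a \<in> {1..n} \<Longrightarrow> b \<in> {1..n} \<Longrightarrow> a \<noteq> b \<Longrightarrow> S \<subseteq> {1..n}
    \<Longrightarrow> \<F> \<subseteq> translate (famH a b) S \<Longrightarrow> KHV_bounded n \<F>"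
  "a \<in> {1..n} \<Longrightarrow> b \<in> {1..n} \<Longrightarrow> c \<in> {1..n} \<Longrightarrow> a \<noteq> b \<Longrightarrow> a \<noteq> c \<Longrightarrow> b \<noteq> c
    \<Longrightarrow> S \<subseteq> {1..n} \<Longrightarrow> \<F> \<subseteq> translate (famV a b c) S \<Longrightarrow> KHV_bounded n \<F>"
  unfolding KHV_bounded_def by metis+

lemma KHV_bounded_translate:
  assumes "S \<subseteq> {1..n}" "KHV_bounded n (translate \<F> S)"
  shows "KHV_bounded n \<F>"
proof -
  have "sym_diff T S \<subseteq> {1..n}" if "T \<subseteq> {1..n}" for T
    using that assms(1) by blast
  then show ?thesis
    using assms(2) unfolding KHV_bounded_def translate_subset_iff translate_translate by meson
qed

text \<open>Adding \<open>{a}\<close> sends \<open>{}\<close>, \<open>{a}\<close> and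
  \<open>{a, x}\<close> to \<open>{a}\<close>, \<open>{}\<close> and \<open>{x}\<close>, all of size
  at most 1.\<close>

lemma star_subset_translate_famK:
  assumes "\<And>F. F \<in> \<F> \<Longrightarrow> F \<subseteq> {1..n}" "a \<in> {1..n}"
    and "\<And>F. F \<in> \<F> \<Longrightarrow> F = {} \<or> F = {a} \<or> (\<exists>x. x \<noteq> a \<and> F = {a, x})"
  shows "\<F> \<subseteq> translate (famK n) {a}"
proof
  fix F assume F: "F \<in> \<F>"
  consider "F = {}" | "F = {a}" | x where "x \<noteq> a" "F = {a, x}"
    using assms(3)[OF F] by blast
  then show "F \<in> translate (famK n) {a}"
  proof cases
    case (3 x)
    then show ?thesis
      using assms(1)[OF F] sym_diff_pair_singleton[of a x] mem_famK(2)[of x n]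
      by (simp add: translate_iff)
  qed (use assms(2) in \<open>auto simp: translate_iff mem_famK\<close>)
qed

section \<open>Families with pairwise distances at most 2 that contain the empty set\<close>

context
  fixes n :: nat and \<G> :: "nat set set"
  assumes sub: "\<And>F. F \<in> \<G> \<Longrightarrow> F \<subseteq> {1..n}"
    and dist: "\<And>F F'. F \<in> \<G> \<Longrightarrow> F' \<in> \<G> \<Longrightarrow> card (sym_diff F F') \<le> 2"
    and empty: "{} \<in> \<G>"
begin

private lemma fin: "F \<in> \<G> \<Longrightarrow> finite F"
  using sub finite_subset by blast

private lemma distD:
  assumes "F \<in> \<G>" "F' \<in> \<G>" "x \<in> sym_diff F F'" "y \<in> sym_diff F F'" "z \<in> sym_diff F F'"
  shows "x = y \<or> x = z \<or> y = z"
proof -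
  have "finite (sym_diff F F')"
    using fin assms by blast
  then show ?thesis
    using card_le_2_iff dist[OF assms(1,2)] assms(3-5) by meson
qed

text \<open>The distance from \<open>F\<close> to the member \<open>{}\<close> is the size of
  \<open>F\<close>.\<close>

private lemma member_cases:
  assumes "F \<in> \<G>"
  obtains "F = {}" | x where "F = {x}" | x y where "F = {x, y}" "x \<noteq> y"
  using card_le_2_cases[of F] fin[OF assms] dist[OF assms empty] by auto

lemma KHV_bounded_of_singleton:
  assumes a: "{a} \<in> \<G>"
  shows "KHV_bounded n \<G>"
proof -
  have an: "a \<in> {1..n}"
    using sub[OF a] by simp
  have pair: "a \<in> F \<Longrightarrow> \<exists>x. x \<noteq> a \<and> F = {a, x}" if "F \<in> \<G>" "F \<noteq> {a}" for F
    using that(1) by (cases rule: member_cases) (use that(2) in auto)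
  have single: "\<exists>x. F = {x}" if F: "F \<in> \<G>" "a \<notin> F" "F \<noteq> {}" for F
    using F(1)
  proof (cases rule: member_cases)
    \<comment> \<open>A pair avoiding \<open>a\<close> would differ from \<open>{a}\<close> in the
      three elements \<open>a\<close>, \<open>x\<close>, \<open>y\<close>.\<close>
    case (3 x y)
    then show ?thesis
      using distD[OF F(1) a, of a x y] F(2) by auto
  qed (use F in auto)
  \<comment> \<open>Either no pair occurs, or all nonempty members contain \<open>a\<close>, or
    there are both a pair \<open>F\<close> through \<open>a\<close> and a singleton
    \<open>F'\<close> other than \<open>{a}\<close>.\<close>
  consider "\<And>F. F \<in> \<G> \<Longrightarrow> a \<in> F \<Longrightarrow> F = {a}" | "\<And>F. F \<in> \<G> \<Longrightarrow> a \<notin> F \<Longrightarrow> F = {}"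
    | F F' where "F \<in> \<G>" "a \<in> F" "F \<noteq> {a}" "F' \<in> \<G>" "a \<notin> F'" "F' \<noteq> {}"
    by blast
  then show ?thesis
  proof cases
    case 1
    have "F \<in> translate (famK n) {}" if F: "F \<in> \<G>" for F
    proof -
      have "F = {} \<or> (\<exists>x. F = {x})"
        using 1[OF F] single[OF F] by blast
      then show ?thesis
        using sub[OF F] mem_famK by (auto simp: translate_iff)
    qed
    then show ?thesis
      by (intro KHV_boundedI(1)[of "{}"]) auto
  next
    case 2
    have "\<G> \<subseteq> translate (famK n) {a}"
      by (rule star_subset_translate_famK[OF sub an]) (use 2 pair in blast)+
    then show ?thesis
      by (intro KHV_boundedI(1)[of "{a}"]) (use an in auto)
  next
    case 3
    obtain y where y: "y \<noteq> a" "F = {a, y}"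
      using pair 3 by blast
    obtain x where x: "F' = {x}"
      using single 3 by blast
    \<comment> \<open>Otherwise \<open>{u}\<close> and \<open>{a, v}\<close> are disjoint, at
      distance 3.\<close>
    have eq: "v = u" if "{u} \<in> \<G>" "u \<noteq> a" "{a, v} \<in> \<G>" "v \<noteq> a" for u v
      using distD[OF that(1,3), of a u v] that(2,4) by auto
    have xy: "x = y"
      using eq[of x y] 3 x y by auto
    have "G \<in> translate (famH a x) {}" if G: "G \<in> \<G>" for G
    proof -
      \<comment> \<open>By \<open>eq\<close>, comparison with \<open>{x}\<close> fixes the pairs
        through \<open>a\<close>, and comparison with \<open>{a, y}\<close> fixes the singletons
        other than \<open>{a}\<close>.\<close>
      have "G = {a} \<or> G = {a, x} \<or> G = {} \<or> G = {x}"
      proof (cases "a \<in> G")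
        case True
        then show ?thesis
          using pair[OF G] eq[of x] 3 x G by auto
      next
        case False
        then show ?thesis
          using single[OF G] eq[of _ y] 3 y G xy by auto
      qed
      then show ?thesis
        by (auto simp: translate_iff famH_def)
    qed
    moreover have "x \<in> {1..n}"
      using sub[of F'] 3 x by auto
    ultimately show ?thesis
      by (intro KHV_boundedI(2)[of a _ x "{}"] subsetI) (use an y(1) xy in simp_all)
  qed
qed

lemma KHV_bounded_of_no_singleton:
  assumes no: "\<And>a. {a} \<notin> \<G>"
  shows "KHV_bounded n \<G>"
proof -
  have pair: "\<exists>x y. x \<noteq> y \<and> F = {x, y}" if "F \<in> \<G>" "F \<noteq> {}" for F
    using that(1) by (cases rule: member_cases) (use that no in auto)
  have pairD: "\<exists>y. y \<noteq> x \<and> F = {x, y}" if "F \<in> \<G>" "x \<in> F" for F x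
    using that(1) by (cases rule: member_cases) (use that no in \<open>auto simp: doubleton_eq_iff\<close>)
  \<comment> \<open>Disjoint pairs would be at distance 4; \<open>u\<close>, \<open>v\<close>,
    \<open>x\<close> already give three distinct elements.\<close>
  have meet: "u = x \<or> u = y \<or> v = x \<or> v = y"
    if "{u, v} \<in> \<G>" "{x, y} \<in> \<G>" "u \<noteq> v" "x \<noteq> y" for u v x y
    using distD[OF that(1,2), of u v x] that(3,4) by auto
  have star: ?thesis if a: "a \<in> {1..n}" "\<And>F. F \<in> \<G> \<Longrightarrow> F \<noteq> {} \<Longrightarrow> a \<in> F" for a
  proof -
    have "\<G> \<subseteq> translate (famK n) {a}"
      by (rule star_subset_translate_famK[OF sub a(1)]) (use a(2) pairD in blast)+
    then show ?thesis
      by (intro KHV_boundedI(1)[of "{a}"]) (use a(1) in auto)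
  qed
  show ?thesis
  proof (cases "\<G> = {{}}")
    case True
    then have "\<G> \<subseteq> translate (famK n) {}"
      by (auto simp: translate_iff mem_famK)
    then show ?thesis
      by (intro KHV_boundedI(1)[of "{}"]) auto
  next
    case False
    then obtain P where "P \<in> \<G>" "P \<noteq> {}"
      using empty by blast
    then obtain a b where ab: "{a, b} \<in> \<G>" "a \<noteq> b"
      using pair by blast
    have n: "a \<in> {1..n}" "b \<in> {1..n}"
      using sub[OF ab(1)] by auto
    show ?thesis
    proof (rule ccontr)
      assume not: "\<not> ?thesis"
      \<comment> \<open>Neither \<open>a\<close> nor \<open>b\<close> is the centre of a star, so
        some pair misses \<open>a\<close> and some pair misses \<open>b\<close>; each meets
        \<open>{a, b}\<close> in the other point.\<close>
      obtain F where F: "F \<in> \<G>" "F \<noteq> {}" "a \<notin> F"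
        using not star[OF n(1)] by blast
      obtain F' where F': "F' \<in> \<G>" "F' \<noteq> {}" "b \<notin> F'"
        using not star[OF n(2)] by blast
      have "b \<in> F"
        using pair[OF F(1,2)] meet[OF ab(1)] ab(2) F by auto
      then obtain c where c: "c \<noteq> b" "F = {b, c}"
        using pairD[OF F(1)] by blast
      have "a \<in> F'"
        using pair[OF F'(1,2)] meet[OF ab(1)] ab(2) F' by auto
      then obtain d where d: "d \<noteq> a" "F' = {a, d}"
        using pairD[OF F'(1)] by blast
      \<comment> \<open>\<open>{b, c}\<close> and \<open>{a, d}\<close> must meet, while
        \<open>a\<close> is not in \<open>F\<close> and \<open>b\<close> is not in
        \<open>F'\<close>; this closes the triangle.\<close>
      have "d = c"
        using meet[of b c a d] F F' c d ab by auto
      then have bc: "{b, c} \<in> \<G>" and ac: "{a, c} \<in> \<G>" and neq: "c \<noteq> a"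
        using F F' c d by auto
      \<comment> \<open>Adding \<open>{a}\<close> turns \<open>{}\<close> and the sides
        \<open>{a, b}\<close>, \<open>{a, c}\<close>, \<open>{b, c}\<close> into \<open>{a}\<close>,
        \<open>{b}\<close>, \<open>{c}\<close>, \<open>{a, b, c}\<close>.\<close>
      have "G \<in> translate (famV a b c) {a}" if G: "G \<in> \<G>" for G
      proof -
        \<comment> \<open>A pair that meets all three sides of the triangle contains two of its
          vertices.\<close>
        have "G = {} \<or> G = {a, b} \<or> G = {a, c} \<or> G = {b, c}"
        proof (rule ccontr)
          assume "\<not> ?thesis"
          moreover from this obtain x y where xy: "x \<noteq> y" "G = {x, y}"
            using pair[OF G] by blast
          ultimately show False
            using meet[of x y, OF _ ab(1)] meet[of x y, OF _ bc] meet[of x y, OF _ ac]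
              G ab(2) c(1) neq by (auto simp: doubleton_eq_iff)
        qed
        moreover have "sym_diff {b, c} {a} = {a, b, c}"
          using ab(2) neq by blast
        ultimately show ?thesis
          using sym_diff_pair_singleton[OF ab(2)] sym_diff_pair_singleton[OF neq[symmetric]]
          by (elim disjE) (simp_all add: translate_iff famV_def)
      qed
      moreover have "c \<in> {1..n}"
        using sub[OF bc] by auto
      ultimately have "KHV_bounded n \<G>"
        using n ab(2) c(1) neq by (intro KHV_boundedI(3)[of a _ b c "{a}"] subsetI) simp_all
      with not show False ..
    qed
  qed
qed

end

theorem theorem2p1:
  fixes n :: nat and \<F> :: "nat set set"
  assumes "n > 0"
    and "\<F> \<subseteq> Pow {1..n}"
    and "diam \<F> \<le> 2"
  shows "(\<exists>S. S \<subseteq> {1..n} \<and> \<F> \<subseteq> translate (famK n) S)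
    \<or> (\<exists>a b S. a \<in> {1..n} \<and> b \<in> {1..n} \<and> a \<noteq> b \<and> S \<subseteq> {1..n}
          \<and> \<F> \<subseteq> translate (famH a b) S)
    \<or> (\<exists>a b c S. a \<in> {1..n} \<and> b \<in> {1..n} \<and> c \<in> {1..n}
          \<and> a \<noteq> b \<and> a \<noteq> c \<and> b \<noteq> c \<and> S \<subseteq> {1..n}
          \<and> \<F> \<subseteq> translate (famV a b c) S)"
proof (cases "\<F> = {}")
  case True
  then show ?thesis
    by blast
next
  case False
  then obtain S where S: "S \<in> \<F>"
    by blast
  then have Sn: "S \<subseteq> {1..n}"
    using assms(2) by blast
  \<comment> \<open>Translating by a member \<open>S\<close> puts \<open>S + S = {}\<close> into the
    family.\<close>
  let ?G = "translate \<F> S"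
  have sub: "F \<subseteq> {1..n}" if "F \<in> ?G" for F
    using that Sn assms(2) by (auto simp: translate_def)
  have dist: "card (sym_diff F F') \<le> 2" if "F \<in> ?G" "F' \<in> ?G" for F F'
  proof -
    \<comment> \<open>Translation preserves distances, since the two copies of \<open>S\<close>
      cancel.\<close>
    have "sym_diff F F' = sym_diff (sym_diff F S) (sym_diff F' S)"
      by blast
    then show ?thesis
      using that card_sym_diff_le_diam[OF assms(2)] assms(3)
      unfolding translate_iff by (metis order_trans)
  qed
  have "{} \<in> ?G"
    using S by (simp add: translate_iff)
  then have "KHV_bounded n ?G"
    using KHV_bounded_of_singleton[of ?G n, OF sub dist]
      KHV_bounded_of_no_singleton[of ?G n, OF sub dist] by blast
  then have "KHV_bounded n \<F>"
    by (rule KHV_bounded_translate[OF Sn])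
  then show ?thesis
    unfolding KHV_bounded_def .
qed

end
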